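(* Let $C\ge0$ be a constant and define $$P^{\mathrm{covering}}_{\mathrm{distr}}:\quad\min\{\mathbf c^T\mathbf x\mid\mathbf A\mathbf x\ge\mathbf b,\ \mathbf 0\le\mathbf x\le C\boldsymbol\xi\}.$$ Let $J=\{j_1,\dots,j_K\}$ be drawn i.i.d. from $\boldsymbol\xi$, and let $$U^{\mathrm{covering}}=\max_{i,j}\left\{\frac{c_j}{A_{i,j}}\ \Big|\ A_{i,j}>0\right\}.$$ For any $\delta\in(0,1)$, with probability at least $1-\delta$ over the sample $J$, the following implication holds: if $P^{\mathrm{covering}}_J$ is feasible, then $$\Delta v(P^{\mathrm{covering}}_J)\le\Delta v(P^{\mathrm{covering}}_{\mathrm{distr}})+\frac{C}{\sqrt K}\cdot\left(1+U^{\mathrm{covering}}\cdot m\cdot\|\mathbf A\|_{\max}\right)\cdot\left(1+\sqrt{2\log\frac2\delta}\right).$$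
   Context: The complete problem is the covering LP $P^{\mathrm{covering}}:\ \min\{\mathbf c^T\mathbf x\mid\mathbf A\mathbf x\ge\mathbf b,\ \mathbf x\ge\mathbf 0\}$, where $\mathbf A\in\mathbb R^{m\times n}$, $\mathbf b\in\mathbb R^m$ and $\mathbf c\in\mathbb R^n$ are all (entrywise) nonnegative, for every $i\in\{1,\dots,m\}$ there is a $j\in\{1,\dots,n\}$ with $A_{i,j}>0$, and $\|\mathbf c\|_2=1$. $\|\mathbf A\|_{\max}=\max_{i,j}|A_{i,j}|$. $\boldsymbol\xi$ is a probability distribution on $[n]=\{1,\dots,n\}$; $j_1,\dots,j_K$ are independent with $\Pr[j_k=t]=\xi_t$ (repetitions possible). $\mathbf A_J$ is the matrix whose columns are columns $j_1,\dots,j_K$ of $\mathbf A$, $\mathbf c_J=(c_{j_1},\dots,c_{j_K})$, and $P^{\mathrm{covering}}_J:\ \min\{\mathbf c_J^T\tilde{\mathbf x}\mid\mathbf A_J\tilde{\mathbf x}\ge\mathbf b,\ \tilde{\mathbf x}\ge\mathbf 0\}$. $v(\cdot)$ denotes the optimal value, with $v=+\infty$ for an infeasible minimization problem, and $\Delta v(P'')=v(P'')-v(P^{\mathrm{covering}})$. *)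

theory Defs
  imports "HOL-Probability.Probability"
begin

text \<open>
  The order on \<open>real ^ 'n\<close> and \<open>real ^ 'n ^ 'm\<close> is the entrywise one (\<open>less_eq_vec_def\<close>), and
  \<open>norm\<close> on \<open>real ^ 'n\<close> is the Euclidean norm.
\<close>

definition covering_feasible :: "real ^ 'n ^ 'm \<Rightarrow> real ^ 'm \<Rightarrow> (real ^ 'n) set" where
  "covering_feasible A b = {x. A *v x \<ge> b \<and> x \<ge> 0}"

definition distr_feasible ::
    "real ^ 'n ^ 'm \<Rightarrow> real ^ 'm \<Rightarrow> real \<Rightarrow> 'n pmf \<Rightarrow> (real ^ 'n) set" where
  "distr_feasible A b C \<xi> = {x. A *v x \<ge> b \<and> 0 \<le> x \<and> x \<le> (\<chi> j. C * pmf \<xi> j)}"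

text \<open>The infimum of the empty set is \<open>\<infinity>\<close>, so an infeasible problem has value \<open>\<infinity>\<close>.\<close>

definition lp_value :: "real ^ 'n \<Rightarrow> (real ^ 'n) set \<Rightarrow> ereal" where
  "lp_value c F = (INF x\<in>F. ereal (c \<bullet> x))"

text \<open>
  A sample of size \<open>K = CARD('k)\<close> is a function from the index type \<open>'k\<close> to the column
  indices; a column drawn repeatedly is repeated in the sampled problem.
\<close>

definition sampled_cols :: "real ^ 'n ^ 'm \<Rightarrow> ('k \<Rightarrow> 'n) \<Rightarrow> real ^ 'k ^ 'm" where
  "sampled_cols A J = (\<chi> i k. A $ i $ J k)"

definition sampled_vec :: "real ^ 'n \<Rightarrow> ('k \<Rightarrow> 'n) \<Rightarrow> real ^ 'k" where
  "sampled_vec c J = (\<chi> k. c $ J k)"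

definition iid_sample :: "'n pmf \<Rightarrow> ('k::finite \<Rightarrow> 'n) pmf" where
  "iid_sample \<xi> = Pi_pmf UNIV undefined (\<lambda>_. \<xi>)"

definition max_norm :: "real ^ 'n ^ 'm \<Rightarrow> real" where
  "max_norm A = Max {\<bar>A $ i $ j\<bar> | i j. True}"

definition U_covering :: "real ^ 'n ^ 'm \<Rightarrow> real ^ 'n \<Rightarrow> real" where
  "U_covering A c = Max {c $ j / A $ i $ j | i j. A $ i $ j > 0}"

text \<open>
  In the next two definitions the subtrahend is finite whenever \<open>A\<close>, \<open>b\<close> and \<open>c\<close> are nonnegative
  and every row of \<open>A\<close> has a positive entry, so the subtraction on \<open>ereal\<close> is unproblematic.
\<close>

definition Delta_v_sampled ::
    "real ^ 'n ^ 'm \<Rightarrow> real ^ 'm \<Rightarrow> real ^ 'n \<Rightarrow> ('k::finite \<Rightarrow> 'n) \<Rightarrow> ereal" where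
  "Delta_v_sampled A b c J =
     lp_value (sampled_vec c J) (covering_feasible (sampled_cols A J) b)
       - lp_value c (covering_feasible A b)"

definition Delta_v_distr ::
    "real ^ 'n ^ 'm \<Rightarrow> real ^ 'm \<Rightarrow> real ^ 'n \<Rightarrow> real \<Rightarrow> 'n pmf \<Rightarrow> ereal" where
  "Delta_v_distr A b c C \<xi> =
     lp_value c (distr_feasible A b C \<xi>) - lp_value c (covering_feasible A b)"

end

theory Submission
  imports Defs
begin

text \<open>
  Scale an optimal solution \<open>x\<close> of the distributional problem to \<open>y\<^sub>k = x\<^bsub>J k\<^esub> / (K \<xi>\<^bsub>J k\<^esub>)\<close>,
  whose entries are at most \<open>C / K\<close>; the sampled costs and the sampled left-hand sides at \<open>y\<close>
  are then unbiased estimators of \<open>c \<bullet> x\<close> and \<open>A x\<close>. If the sampled problem is feasible, a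
  shortfall \<open>r\<close> in one row can be repaired by raising a single variable, at cost at most
  \<open>U r\<close>, so the sampled optimum exceeds \<open>c \<bullet> x\<close> by at most a weighted sum of positive parts of
  centred i.i.d. sums. The exponential moment of this weighted sum is bounded by Jensen's
  inequality and Hoeffding's lemma. No union bound over the rows is taken, so no logarithm of
  \<open>m\<close> appears.
\<close>

section \<open>Concentration\<close>

text \<open>Independence turns the exponential moment of the sum into a product of equal factors,
  one per draw, and Hoeffding's lemma bounds each of them by
  \<open>exp (l\<^sup>2 * D\<^sup>2 / 8)\<close>.\<close>

lemma Hoeffding_mgf_Pi_pmf:
  fixes p :: "'a pmf" and g :: "'a \<Rightarrow> real"
  assumes l: "l > 0" and g: "\<And>x. g x \<in> {a..a + D}"
  defines "\<mu> \<equiv> measure_pmf.expectation p g"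
  shows "measure_pmf.expectation (Pi_pmf (UNIV :: 'k::finite set) d (\<lambda>_. p))
           (\<lambda>J. exp (l * (\<Sum>k\<in>UNIV. g (J k) - \<mu>)))
         \<le> exp (l\<^sup>2 * D\<^sup>2 * real CARD('k) / 8)"
proof -
  interpret interval_bounded_random_variable "measure_pmf p" g a "a + D"
    by unfold_locales (use g in auto)
  have bound: "\<bar>g x - \<mu>\<bar> \<le> \<bar>a\<bar> + \<bar>D\<bar> + \<bar>\<mu>\<bar>" for x
    using g[of x] by auto
  \<comment> \<open>Hoeffding's lemma enters as a bound on a nonnegative integral. Boundedness of
    \<open>g\<close> gives the integrability that carries it over to \<open>expectation\<close> and
    lets the product factorize.\<close>
  have int: "integrable (measure_pmf p) (\<lambda>x. exp (l * (g x - \<mu>)))"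
  proof (rule measure_pmf.integrable_const_bound)
    show "AE x in measure_pmf p. norm (exp (l * (g x - \<mu>))) \<le> exp (l * (\<bar>a\<bar> + \<bar>D\<bar> + \<bar>\<mu>\<bar>))"
    proof (rule AE_pmfI)
      fix x
      have "g x - \<mu> \<le> \<bar>a\<bar> + \<bar>D\<bar> + \<bar>\<mu>\<bar>" using bound[of x] by linarith
      then show "norm (exp (l * (g x - \<mu>))) \<le> exp (l * (\<bar>a\<bar> + \<bar>D\<bar> + \<bar>\<mu>\<bar>))"
        using l by simp
    qed
  qed auto
  have "ennreal (measure_pmf.expectation p (\<lambda>x. exp (l * (g x - \<mu>))))
      = nn_integral p (\<lambda>x. exp (l * (g x - \<mu>)))"
    using int by (intro nn_integral_eq_integral[symmetric]) auto
  also have "\<dots> \<le> ennreal (exp (l\<^sup>2 * D\<^sup>2 / 8))"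
    using Hoeffdings_lemma_nn_integral[OF l] by (simp add: \<mu>_def)
  finally have one: "measure_pmf.expectation p (\<lambda>x. exp (l * (g x - \<mu>))) \<le> exp (l\<^sup>2 * D\<^sup>2 / 8)"
    by simp
  have "measure_pmf.expectation (Pi_pmf (UNIV :: 'k set) d (\<lambda>_. p))
           (\<lambda>J. exp (l * (\<Sum>k\<in>UNIV. g (J k) - \<mu>)))
      = measure_pmf.expectation (Pi_pmf (UNIV :: 'k set) d (\<lambda>_. p))
           (\<lambda>J. \<Prod>k\<in>UNIV. exp (l * (g (J k) - \<mu>)))"
    by (simp only: sum_distrib_left exp_sum[OF finite])
  also have "\<dots> = (\<Prod>k\<in>(UNIV :: 'k set). measure_pmf.expectation p (\<lambda>x. exp (l * (g x - \<mu>))))"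
    using int by (intro expectation_prod_Pi_pmf) auto
  also have "\<dots> \<le> (\<Prod>k\<in>(UNIV :: 'k set). exp (l\<^sup>2 * D\<^sup>2 / 8))"
    using one by (intro prod_mono) (auto intro!: Bochner_Integration.integral_nonneg)
  also have "\<dots> = exp (l\<^sup>2 * D\<^sup>2 * real CARD('k) / 8)"
    by (simp add: exp_of_nat_mult[symmetric] algebra_simps)
  finally show ?thesis .
qed

text \<open>Chernoff's method applied to \<open>Z J / sum w I\<close>, a convex combination of
  positive parts: convexity of \<open>exp\<close> leaves an average of single exponential moments,
  all with the same bound because the ranges share the length \<open>D\<close>.\<close>

lemma prob_weighted_positive_parts_gt:
  fixes p :: "'a::finite pmf" and g :: "'i \<Rightarrow> 'a \<Rightarrow> real" and w :: "'i \<Rightarrow> real"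
  assumes fin: "finite I" and w: "\<And>i. i \<in> I \<Longrightarrow> w i \<ge> 0" and pos: "sum w I > 0"
    and D: "D \<ge> 0" and g: "\<And>i x. i \<in> I \<Longrightarrow> g i x \<in> {a i..a i + D}"
    and \<delta>: "0 < \<delta>" "\<delta> < 1"
  defines "\<mu> \<equiv> \<lambda>i. measure_pmf.expectation p (g i)"
  defines "Z \<equiv> \<lambda>J :: 'k::finite \<Rightarrow> 'a. \<Sum>i\<in>I. w i * max 0 (\<Sum>k\<in>UNIV. g i (J k) - \<mu> i)"
  shows "measure_pmf.prob (Pi_pmf UNIV d (\<lambda>_. p))
           {J. Z J > sum w I * (D * sqrt (real CARD('k) * ln (2 / \<delta>) / 2))} \<le> \<delta>"
proof (cases "D = 0")
  \<comment> \<open>Split off because the parameter \<open>l\<close> chosen below divides by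
    \<open>D\<close>; here each \<open>g i\<close> is constant and equals its mean.\<close>
  case True
  have "g i = (\<lambda>_. a i)" if "i \<in> I" for i
    using g[OF that] True by auto
  then have "Z J = 0" for J
    unfolding Z_def \<mu>_def by (intro sum.neutral) simp
  then show ?thesis using True \<delta> by simp
next
  case False
  with D have D: "D > 0" by simp
  define P where "P = Pi_pmf (UNIV :: 'k set) d (\<lambda>_. p)"
  define S where "S = (\<lambda>i (J :: 'k \<Rightarrow> 'a). \<Sum>k\<in>UNIV. g i (J k) - \<mu> i)"
  define W where "W = sum w I"
  define L where "L = ln (2 / \<delta>)"
  \<comment> \<open>The exponent \<open>v - l * t\<close> is quadratic in \<open>l\<close>. The
    \<open>l\<close> below is its minimiser, and \<open>t\<close> is the value for which the minimum
    is exactly \<open>- L\<close>.\<close>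
  define t where "t = D * sqrt (real CARD('k) * L / 2)"
  define l where "l = 4 * t / (real CARD('k) * D\<^sup>2)"
  define v where "v = l\<^sup>2 * D\<^sup>2 * real CARD('k) / 8"
  have W: "W > 0" using pos by (simp add: W_def)
  have L: "L > 0" using \<delta> by (simp add: L_def)
  have t: "t > 0" using D L by (simp add: t_def)
  have l: "l > 0" using t D by (simp add: l_def)
  have t2: "t\<^sup>2 = D\<^sup>2 * real CARD('k) * L / 2"
    using L by (simp add: t_def power_mult_distrib)
  have exponent: "v - l * t = - L"
    unfolding v_def l_def using t2 D by (simp add: field_simps power2_eq_square)
  have [simp]: "integrable (measure_pmf P) (f :: ('k \<Rightarrow> 'a) \<Rightarrow> real)" for f
    by (rule integrable_measure_pmf_finite) (rule finite)
  have v: "v \<ge> 0" by (simp add: v_def)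
  \<comment> \<open>Jensen with weights \<open>w i / W\<close>, then
    \<open>exp (max 0 s) = max 1 (exp s) \<le> 1 + exp s\<close> for
    \<open>s = l * S i J\<close>.\<close>
  have jensen: "exp (l * (Z J / W)) \<le> (\<Sum>i\<in>I. (w i / W) * (1 + exp (l * S i J)))" for J
  proof -
    have "exp (\<Sum>i\<in>I. (w i / W) *\<^sub>R (l * max 0 (S i J)))
        \<le> (\<Sum>i\<in>I. (w i / W) * exp (l * max 0 (S i J)))"
      using fin pos w W
      by (intro convex_on_sum[OF _ _ exp_convex])
         (auto simp: W_def simp flip: sum_divide_distrib)
    also have "\<dots> \<le> (\<Sum>i\<in>I. (w i / W) * (1 + exp (l * S i J)))"
      using w W by (intro sum_mono mult_left_mono) (auto simp: max_def)
    also have "(\<Sum>i\<in>I. (w i / W) *\<^sub>R (l * max 0 (S i J))) = l * (Z J / W)"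
      by (simp add: Z_def S_def sum_distrib_left sum_divide_distrib mult_ac)
    finally show ?thesis .
  qed
  have mgf: "measure_pmf.expectation P (\<lambda>J. exp (l * S i J)) \<le> exp v" if "i \<in> I" for i
    unfolding P_def S_def v_def \<mu>_def by (rule Hoeffding_mgf_Pi_pmf[OF l g[OF that]])
  have "measure_pmf.expectation P (\<lambda>J. exp (l * (Z J / W)))
      \<le> measure_pmf.expectation P (\<lambda>J. \<Sum>i\<in>I. (w i / W) * (1 + exp (l * S i J)))"
    by (intro integral_mono jensen) auto
  also have "\<dots> = (\<Sum>i\<in>I. (w i / W) * (1 + measure_pmf.expectation P (\<lambda>J. exp (l * S i J))))"
    by simp
  also have "\<dots> \<le> (\<Sum>i\<in>I. (w i / W) * (2 * exp v))"
  proof (intro sum_mono mult_left_mono)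
    fix i assume i: "i \<in> I"
    \<comment> \<open>From \<open>v \<ge> 0\<close> the summand 1 is at most \<open>exp v\<close>;
      the resulting factor 2 is the one inside \<open>ln (2 / \<delta>)\<close>.\<close>
    show "1 + measure_pmf.expectation P (\<lambda>J. exp (l * S i J)) \<le> 2 * exp v"
      using mgf[OF i] one_le_exp_iff[of v] v by linarith
    show "0 \<le> w i / W" using w[OF i] W by simp
  qed
  also have "\<dots> = 2 * exp v"
    using W by (simp add: W_def flip: sum_distrib_right sum_divide_distrib)
  finally have E: "measure_pmf.expectation P (\<lambda>J. exp (l * (Z J / W))) \<le> 2 * exp v" .
  \<comment> \<open>Markov's inequality for the exponential moment.\<close>
  have "measure_pmf.prob P {J. Z J > W * t}
      \<le> measure_pmf.prob P {J. exp (l * (Z J / W)) \<ge> exp (l * t)}"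
    using W l by (intro measure_pmf.finite_measure_mono) (auto simp: field_simps)
  also have "\<dots> \<le> measure_pmf.expectation P (\<lambda>J. exp (l * (Z J / W))) / exp (l * t)"
    using integral_Markov_inequality_measure
      [of P "\<lambda>J. exp (l * (Z J / W))" UNIV "exp (l * t)"] by simp
  also have "\<dots> \<le> 2 * exp v / exp (l * t)"
    using E by (intro divide_right_mono) auto
  also have "\<dots> = 2 * exp (- L)"
    unfolding exponent[symmetric] by (simp add: exp_diff)
  also have "\<dots> = \<delta>"
    using \<delta> by (simp add: L_def exp_minus)
  finally show ?thesis
    by (simp add: P_def W_def t_def L_def)
qed

section \<open>Covering problems\<close>

text \<open>Each deficient row gets a variable of its own with a positive coefficient there. As
  \<open>B \<ge> 0\<close>, raising it never lowers another row, so the repairs can simply be added;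
  the ratio bound \<open>U\<close> prices each one.\<close>

lemma covering_repair:
  fixes B :: "real ^ 'k ^ 'm" and b :: "real ^ 'm" and d x :: "real ^ 'k"
  assumes B: "B \<ge> 0" and x: "x \<ge> 0" and feas: "covering_feasible B b \<noteq> {}"
    and U: "\<And>i k. B $ i $ k > 0 \<Longrightarrow> d $ k / B $ i $ k \<le> U"
  obtains z where "z \<in> covering_feasible B b"
    and "d \<bullet> z \<le> d \<bullet> x + U * (\<Sum>i\<in>UNIV. max 0 (b $ i - (B *v x) $ i))"
proof -
  define r where "r = (\<lambda>i. max 0 (b $ i - (B *v x) $ i))"
  have Bnn: "B $ i $ k \<ge> 0" for i k
    using B by (auto simp: less_eq_vec_def)
  have xnn: "x $ k \<ge> 0" for k
    using x by (auto simp: less_eq_vec_def)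
  have nonneg: "(B *v y) $ i \<ge> 0" if "\<And>k. y $ k \<ge> 0" for y :: "real ^ 'k" and i
    using that Bnn by (auto simp: matrix_vector_mult_def intro!: sum_nonneg)
  \<comment> \<open>Feasibility is used here: a zero row forces \<open>b $ i \<le> 0\<close>, and
    then \<open>B *v x \<ge> 0\<close> leaves no shortfall. The implication sits under the
    quantifier so that the choice of column is total in \<open>i\<close>.\<close>
  have ex: "\<exists>k. r i > 0 \<longrightarrow> B $ i $ k > 0" for i
  proof (rule ccontr)
    assume *: "\<not> ?thesis"
    then have zero: "B $ i $ k = 0" for k
      using Bnn[of i k] by (auto simp: not_less intro: antisym)
    obtain y where "y \<in> covering_feasible B b" using feas by auto
    then have "b $ i \<le> (B *v y) $ i"
      by (simp add: covering_feasible_def less_eq_vec_def)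
    also have "\<dots> = 0" by (simp add: matrix_vector_mult_def zero)
    finally have "b $ i \<le> 0" .
    moreover have "(B *v x) $ i \<ge> 0" using nonneg xnn by simp
    ultimately have "r i = 0" by (simp add: r_def)
    with * show False by simp
  qed
  then obtain \<kappa> where \<kappa>: "\<And>i. r i > 0 \<Longrightarrow> B $ i $ \<kappa> i > 0" by metis
  \<comment> \<open>The raise that closes the gap of row \<open>i\<close> exactly; it is the zero
    vector when \<open>r i = 0\<close>.\<close>
  define e where "e = (\<lambda>i. axis (\<kappa> i) (r i / B $ i $ \<kappa> i))"
  define z where "z = x + (\<Sum>i\<in>UNIV. e i)"
  have r0: "r i \<ge> 0" for i by (simp add: r_def)
  have e0: "e i $ k \<ge> 0" for i k
    using r0 Bnn by (simp add: e_def axis_def)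
  have Be: "(B *v e i) $ i = r i" for i
  proof (cases "r i > 0")
    case True
    then show ?thesis
      using \<kappa>[OF True]
      by (simp add: e_def matrix_vector_mult_def axis_def if_distrib cong: if_cong)
  next
    case False
    then have "r i = 0" using r0[of i] by simp
    then show ?thesis
      by (simp add: e_def matrix_vector_mult_def axis_def if_distrib cong: if_cong)
  qed
  have "b $ i \<le> (B *v z) $ i" for i
  proof -
    have "b $ i \<le> (B *v x) $ i + (B *v e i) $ i"
      by (simp add: Be r_def)
    also have "\<dots> \<le> (B *v x) $ i + (\<Sum>i'\<in>UNIV. (B *v e i') $ i)"
      using member_le_sum[of i UNIV "\<lambda>i'. (B *v e i') $ i"] nonneg e0 by simp
    also have "\<dots> = (B *v z) $ i"
      by (simp add: z_def matrix_vector_right_distrib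
            linear_sum[OF matrix_vector_mul_linear, symmetric] flip: sum_component)
    finally show ?thesis .
  qed
  moreover have "z $ k \<ge> 0" for k
    using xnn e0 by (simp add: z_def sum_nonneg)
  ultimately have feasible: "z \<in> covering_feasible B b"
    by (simp add: covering_feasible_def less_eq_vec_def)
  have "d \<bullet> e i \<le> U * r i" for i
  proof (cases "r i > 0")
    case True
    have "d \<bullet> e i = (d $ \<kappa> i / B $ i $ \<kappa> i) * r i"
      by (simp add: e_def inner_axis)
    also have "\<dots> \<le> U * r i"
      using U[OF \<kappa>[OF True]] r0 by (intro mult_right_mono) auto
    finally show ?thesis .
  next
    case False
    then have "r i = 0" using r0[of i] by simp
    then show ?thesis by (simp add: e_def inner_axis)
  qed
  then have "d \<bullet> z \<le> d \<bullet> x + (\<Sum>i\<in>UNIV. U * r i)"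
    by (simp add: z_def inner_add_right inner_sum_right sum_mono)
  with feasible show ?thesis
    by (intro that) (simp_all add: r_def sum_distrib_left)
qed

section \<open>Attainment and finiteness of optimal values\<close>

lemma compact_distr_feasible: "compact (distr_feasible A b C \<xi>)"
proof -
  have "distr_feasible A b C \<xi>
      = {x. b \<le> A *v x} \<inter> {0..(\<chi> j. C * pmf \<xi> j)}"
    by (auto simp: distr_feasible_def)
  moreover have "{0..(\<chi> j. C * pmf \<xi> j)} = cbox 0 (\<chi> j. C * pmf \<xi> j)"
    by (auto simp: cbox_interval)
  moreover have "closed {x. b \<le> A *v x}"
    by (auto simp: less_eq_vec_def matrix_vector_mult_def
          intro!: closed_Collect_all closed_Collect_le continuous_intros)
  ultimately show ?thesis
    by (simp add: closed_Int_compact)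
qed

lemma distr_minimizer:
  assumes "distr_feasible A b C \<xi> \<noteq> {}"
  obtains x where "x \<in> distr_feasible A b C \<xi>"
    and "lp_value c (distr_feasible A b C \<xi>) = ereal (c \<bullet> x)"
proof -
  have cont: "continuous_on (distr_feasible A b C \<xi>) (\<lambda>x. c \<bullet> x)"
    by (intro continuous_intros)
  obtain x where x: "x \<in> distr_feasible A b C \<xi>"
    and min: "\<And>y. y \<in> distr_feasible A b C \<xi> \<Longrightarrow> c \<bullet> x \<le> c \<bullet> y"
    using continuous_attains_inf[OF compact_distr_feasible assms cont] by blast
  have "lp_value c (distr_feasible A b C \<xi>) = ereal (c \<bullet> x)"
    unfolding lp_value_def
    by (intro antisym INF_lower2[OF x] INF_greatest) (auto intro: min)
  with x show ?thesis by (rule that)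
qed

lemma covering_feasible_nonempty:
  fixes A :: "real ^ 'n ^ 'm"
  assumes A: "A \<ge> 0" and rows: "\<forall>i. \<exists>j. A $ i $ j > 0"
  shows "covering_feasible A b \<noteq> {}"
proof -
  have Ann: "A $ i $ j \<ge> 0" for i j
    using A by (auto simp: less_eq_vec_def)
  define s where "s = (\<lambda>i. \<Sum>j\<in>UNIV. A $ i $ j)"
  have s: "s i > 0" for i
    using rows Ann unfolding s_def by (metis UNIV_I finite sum_pos2)
  \<comment> \<open>A constant vector is feasible once its entry dominates every
    \<open>\<bar>b $ i\<bar> / s i\<close>; the sum of these ratios does.\<close>
  define M where "M = (\<Sum>i\<in>UNIV. \<bar>b $ i\<bar> / s i)"
  have "b $ i \<le> (A *v (\<chi> j. M)) $ i" for i
  proof -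
    have "\<bar>b $ i\<bar> / s i \<le> M"
      unfolding M_def using s by (intro member_le_sum) (auto simp: less_imp_le)
    then have "\<bar>b $ i\<bar> \<le> M * s i" using s[of i] by (simp add: field_simps)
    then show ?thesis
      by (simp add: matrix_vector_mult_def s_def sum_distrib_left mult.commute)
  qed
  moreover have "M \<ge> 0" unfolding M_def using s by (auto intro!: sum_nonneg simp: less_imp_le)
  ultimately have "(\<chi> j. M) \<in> covering_feasible A b"
    by (simp add: covering_feasible_def less_eq_vec_def)
  then show ?thesis by auto
qed

text \<open>Guarantees that both Delta values subtract a real number, so no difference of infinities
  arises. Zero is a lower bound since \<open>c \<ge> 0\<close>, and any feasible point gives an
  upper bound.\<close>

lemma covering_value_finite:
  fixes A :: "real ^ 'n ^ 'm"
  assumes "A \<ge> 0" and c: "c \<ge> 0" and "\<forall>i. \<exists>j. A $ i $ j > 0"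
  obtains v where "lp_value c (covering_feasible A b) = ereal v"
proof -
  obtain y where "y \<in> covering_feasible A b"
    using covering_feasible_nonempty assms by blast
  then have "lp_value c (covering_feasible A b) \<le> ereal (c \<bullet> y)"
    unfolding lp_value_def by (rule INF_lower)
  moreover have "lp_value c (covering_feasible A b) \<ge> 0"
    unfolding lp_value_def using c
    by (intro INF_greatest)
       (auto simp: covering_feasible_def less_eq_vec_def inner_vec_def intro!: sum_nonneg)
  ultimately show ?thesis
    using that by (cases "lp_value c (covering_feasible A b)") auto
qed

lemma max_norm_upper: "\<bar>A $ i $ j\<bar> \<le> max_norm A"
  unfolding max_norm_def
proof (rule Max_ge)
  have "{\<bar>A $ i $ j\<bar> | i j. True} = (\<lambda>(i, j). \<bar>A $ i $ j\<bar>) ` UNIV" by auto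
  then show "finite {\<bar>A $ i $ j\<bar> | i j. True}" by simp
qed auto

lemma U_covering_upper:
  assumes "A $ i $ j > 0"
  shows "c $ j / A $ i $ j \<le> U_covering A c"
  unfolding U_covering_def
proof (rule Max_ge)
  have "{c $ j / A $ i $ j | i j. A $ i $ j > 0} \<subseteq> (\<lambda>(i, j). c $ j / A $ i $ j) ` UNIV" by auto
  then show "finite {c $ j / A $ i $ j | i j. A $ i $ j > 0}"
    by (rule finite_subset) simp
qed (use assms in auto)

section \<open>From the distributional to the sampled problem\<close>

theorem mainTheorem9:
  fixes A :: "real ^ 'n ^ 'm" and b :: "real ^ 'm" and c :: "real ^ 'n"
    and \<xi> :: "'n pmf" and C \<delta> :: real
  assumes "A \<ge> 0" and "b \<ge> 0" and "c \<ge> 0"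
    and "\<forall>i. \<exists>j. A $ i $ j > 0"
    and "norm c = 1"
    and "C \<ge> 0"
    and "0 < \<delta>" and "\<delta> < 1"
  shows "measure_pmf.prob (iid_sample \<xi>)
           {J :: 'k::finite \<Rightarrow> 'n.
              covering_feasible (sampled_cols A J) b \<noteq> {} \<longrightarrow>
              Delta_v_sampled A b c J
                \<le> Delta_v_distr A b c C \<xi>
                   + ereal (C / sqrt (real CARD('k))
                       * (1 + U_covering A c * real CARD('m) * max_norm A)
                       * (1 + sqrt (2 * ln (2 / \<delta>))))}
         \<ge> 1 - \<delta>"
    (is "measure_pmf.prob _ ?good \<ge> _")
proof -
  obtain v where v: "lp_value c (covering_feasible A b) = ereal v"
    using covering_value_finite assms by blast
  show ?thesis
  proof (cases "distr_feasible A b C \<xi> = {}")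
    \<comment> \<open>An infeasible distributional problem makes the right-hand side infinite, so
      every sample is good.\<close>
    case True
    then have "Delta_v_distr A b c C \<xi> = \<infinity>"
      by (simp add: Delta_v_distr_def v lp_value_def top_ereal_def)
    then have "?good = UNIV" by simp
    then show ?thesis using \<open>0 < \<delta>\<close> by simp
  next
    case False
    then obtain x where x: "x \<in> distr_feasible A b C \<xi>"
      and vx: "lp_value c (distr_feasible A b C \<xi>) = ereal (c \<bullet> x)"
      by (rule distr_minimizer)
    define K where "K = real CARD('k)"
    define M where "M = max_norm A"
    define U where "U = U_covering A c"
    have K: "K > 0" by (simp add: K_def)
    have Ann: "A $ i $ j \<ge> 0" and cnn: "c $ j \<ge> 0" for i j
      using assms by (auto simp: less_eq_vec_def)
    \<comment> \<open>One positive entry makes \<open>M\<close> positive, so rows can be divided by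
      it, and shows that \<open>U\<close>, a maximum over a nonempty set, is nonnegative.\<close>
    obtain i0 j0 where pos0: "A $ (i0 :: 'm) $ (j0 :: 'n) > 0" using assms by blast
    have M: "M > 0" using max_norm_upper[of A i0 j0] pos0 by (simp add: M_def)
    have U: "U \<ge> 0"
      using U_covering_upper[OF pos0, of c] cnn[of j0] pos0
      by (auto simp: U_def intro: order_trans[rotated])
    have AM: "A $ i $ j / M \<le> 1" for i j
      using max_norm_upper[of A i j] M by (simp add: M_def)
    have c1: "c $ j \<le> 1" for j
      using component_le_norm_cart[of c j] \<open>norm c = 1\<close> by simp
    \<comment> \<open>Importance weights. If \<open>pmf \<xi> j = 0\<close>, the box constraint
      forces \<open>x $ j = 0\<close>, which agrees with division by zero giving 0, so
      \<open>unbiased\<close> holds there too.\<close>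
    define h where "h = (\<lambda>j. x $ j / (K * pmf \<xi> j))"
    have xnn: "x $ j \<ge> 0" and xC: "x $ j \<le> C * pmf \<xi> j" and Ax: "b $ i \<le> (A *v x) $ i" for i j
      using x by (auto simp: distr_feasible_def less_eq_vec_def)
    have h0: "h j \<ge> 0" for j using xnn K by (simp add: h_def)
    have hC: "h j \<le> C / K" for j
    proof (cases "pmf \<xi> j = 0")
      case True
      then show ?thesis using \<open>C \<ge> 0\<close> K by (simp add: h_def)
    next
      case False
      then have "pmf \<xi> j > 0" by (simp add: pmf_pos)
      then show ?thesis using xC[of j] K by (simp add: h_def field_simps)
    qed
    have unbiased: "measure_pmf.expectation \<xi> (\<lambda>j. q j * h j) = (\<Sum>j\<in>UNIV. q j * x $ j) / K"
      for q :: "'n \<Rightarrow> real"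
    proof -
      have "q j * h j * pmf \<xi> j = q j * x $ j / K" for j
        using xC[of j] xnn[of j] K by (cases "pmf \<xi> j = 0") (auto simp: h_def)
      then show ?thesis
        by (simp add: integral_measure_pmf_real[of UNIV] sum_divide_distrib)
    qed
    text \<open>The index \<open>None\<close> stands for the objective, \<open>Some i\<close> for row \<open>i\<close> scaled by \<open>- 1 / M\<close>.\<close>
    define q where "q = case_option (\<lambda>j. c $ j) (\<lambda>i j. - (A $ i $ j / M))"
    \<comment> \<open>Left ends of the ranges. Since \<open>c $ j \<le> 1\<close> and
      \<open>A $ i $ j / M \<le> 1\<close>, the objective term lies in \<open>{0..C / K}\<close> and
      the negated row terms in \<open>{- (C / K)..0}\<close>, all of length
      \<open>C / K\<close>.\<close>
    define a where "a = case_option 0 (\<lambda>_ :: 'm. - (C / K))"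
    \<comment> \<open>The factor \<open>M\<close> undoes the scaling of the rows, and
      \<open>U\<close> is the price of a unit of shortfall.\<close>
    define w where "w = case_option 1 (\<lambda>_ :: 'm. U * M)"
    define Z where "Z = (\<lambda>J :: 'k \<Rightarrow> 'n. \<Sum>i\<in>UNIV. w i * max 0 (\<Sum>k\<in>UNIV.
        q i (J k) * h (J k) - measure_pmf.expectation \<xi> (\<lambda>j. q i j * h j)))"
    have sum_option: "(\<Sum>i\<in>UNIV. f i) = f None + (\<Sum>i\<in>UNIV. f (Some i))"
      for f :: "'m option \<Rightarrow> real"
      by (simp add: UNIV_option_conv sum.reindex)
    have sum_w: "sum w UNIV = 1 + U * real CARD('m) * M"
      by (simp add: sum_option w_def)
    have range: "q i j * h j \<in> {a i..a i + C / K}" for i j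
    proof -
      have "s * h j \<in> {0..C / K}" if "0 \<le> s" "s \<le> 1" for s
        using that h0[of j] hC[of j] mult_mono[of s 1 "h j" "C / K"] by auto
      from this[of "c $ j"] this[of "A $ the i $ j / M"] show ?thesis
        using cnn c1 Ann AM M by (cases i) (auto simp: q_def a_def)
    qed
    \<comment> \<open>The threshold of \<open>prob_weighted_positive_parts_gt\<close> with
      \<open>D = C / K\<close>.\<close>
    define \<tau> where "\<tau> = sum w UNIV * (C / K * sqrt (K * ln (2 / \<delta>) / 2))"
    have tail: "measure_pmf.prob (iid_sample \<xi>) {J. Z J > \<tau>} \<le> \<delta>"
      unfolding iid_sample_def Z_def \<tau>_def K_def
    proof (rule prob_weighted_positive_parts_gt)
      show "sum w UNIV > 0" using U M by (simp add: sum_w add_pos_nonneg)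
      show "w i \<ge> 0" for i using U M by (cases i) (auto simp: w_def)
      show "q i j * h j \<in> {a i..a i + C / real CARD('k)}" for i j
        using range by (simp add: K_def)
    qed (use assms in auto)
    have \<tau>: "\<tau> \<le> C / sqrt K * (1 + U * real CARD('m) * M) * (1 + sqrt (2 * ln (2 / \<delta>)))"
    proof -
      have L: "ln (2 / \<delta>) > 0" using assms by simp
      have "sqrt (K * ln (2 / \<delta>) / 2) = sqrt K * sqrt (ln (2 / \<delta>) / 2)"
        by (simp add: real_sqrt_mult flip: times_divide_eq_right)
      moreover have "C / K * sqrt K = C / sqrt K"
        using K by (simp add: field_simps)
      ultimately have "C / K * sqrt (K * ln (2 / \<delta>) / 2) = C / sqrt K * sqrt (ln (2 / \<delta>) / 2)"
        by (metis mult.assoc)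
      \<comment> \<open>The tail bound carries \<open>sqrt (ln (2 / \<delta>) / 2)\<close>, which is
        below the claimed \<open>1 + sqrt (2 * ln (2 / \<delta>))\<close>.\<close>
      then have "\<tau> = C / sqrt K * (1 + U * real CARD('m) * M) * sqrt (ln (2 / \<delta>) / 2)"
        by (simp add: \<tau>_def sum_w mult_ac)
      also have "\<dots> \<le> C / sqrt K * (1 + U * real CARD('m) * M) * (1 + sqrt (2 * ln (2 / \<delta>)))"
      proof (rule mult_left_mono)
        have "sqrt (ln (2 / \<delta>) / 2) \<le> sqrt (2 * ln (2 / \<delta>))"
          using L by (intro real_sqrt_le_mono) simp
        then show "sqrt (ln (2 / \<delta>) / 2) \<le> 1 + sqrt (2 * ln (2 / \<delta>))" by linarith
        show "0 \<le> C / sqrt K * (1 + U * real CARD('m) * M)"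
          using \<open>C \<ge> 0\<close> K U M by simp
      qed
      finally show ?thesis .
    qed
    have "J \<in> ?good" if J: "Z J \<le> \<tau>" for J
    proof -
      have "Delta_v_sampled A b c J \<le> Delta_v_distr A b c C \<xi> + ereal \<tau>"
        if feas: "covering_feasible (sampled_cols A J) b \<noteq> {}"
      proof -
        define y where "y = (\<chi> k. h (J k))"
        have "sampled_cols A J \<ge> 0" and "y \<ge> 0"
          using Ann h0 by (auto simp: less_eq_vec_def sampled_cols_def y_def)
        \<comment> \<open>Sampled columns are columns of \<open>A\<close> with their own costs, so
          \<open>U_covering A c\<close> bounds the sampled ratios as well.\<close>
        then obtain z where z: "z \<in> covering_feasible (sampled_cols A J) b"
          and cost: "sampled_vec c J \<bullet> z \<le> sampled_vec c J \<bullet> y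
            + U * (\<Sum>i\<in>UNIV. max 0 (b $ i - (sampled_cols A J *v y) $ i))"
          by (rule covering_repair[OF _ _ feas, where d = "sampled_vec c J" and U = U])
             (auto simp: sampled_cols_def sampled_vec_def U_def intro: U_covering_upper)
        \<comment> \<open>Each draw has mean \<open>1 / K\<close> of the full sum, and there are
          \<open>K\<close> draws.\<close>
        have centred: "(\<Sum>k\<in>UNIV. q i (J k) * h (J k)
              - measure_pmf.expectation \<xi> (\<lambda>j. q i j * h j))
            = (\<Sum>k\<in>UNIV. q i (J k) * h (J k)) - (\<Sum>j\<in>UNIV. q i j * x $ j)" for i
          using K by (simp add: unbiased sum_subtractf K_def)
        \<comment> \<open>Since \<open>b \<le> A *v x\<close>, the shortfall is at most the amount
          by which the sampled row falls below its mean; the minus sign in \<open>q\<close> makes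
          this an upward deviation.\<close>
        have row: "max 0 (b $ i - (sampled_cols A J *v y) $ i)
            \<le> M * max 0 ((\<Sum>k\<in>UNIV. q (Some i) (J k) * h (J k))
                          - (\<Sum>j\<in>UNIV. q (Some i) j * x $ j))" for i
        proof -
          have "M * ((\<Sum>k\<in>UNIV. q (Some i) (J k) * h (J k)) - (\<Sum>j\<in>UNIV. q (Some i) j * x $ j))
              = (A *v x) $ i - (sampled_cols A J *v y) $ i"
            using M by (simp add: q_def y_def sampled_cols_def matrix_vector_mult_def
                sum_negf right_diff_distrib sum_distrib_left)
          then show ?thesis
            using Ax[of i] M by (simp add: max_mult_distrib_left)
        qed
        have "sampled_vec c J \<bullet> z \<le> c \<bullet> x + Z J"
        proof -
          have "U * (\<Sum>i\<in>UNIV. max 0 (b $ i - (sampled_cols A J *v y) $ i))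
              \<le> U * (\<Sum>i\<in>UNIV. M * max 0 ((\<Sum>k\<in>UNIV. q (Some i) (J k) * h (J k))
                          - (\<Sum>j\<in>UNIV. q (Some i) j * x $ j)))"
            by (intro mult_left_mono sum_mono row U)
          moreover have "sampled_vec c J \<bullet> y - c \<bullet> x \<le> max 0
              ((\<Sum>k\<in>UNIV. q None (J k) * h (J k)) - (\<Sum>j\<in>UNIV. q None j * x $ j))"
            by (simp add: q_def y_def sampled_vec_def inner_vec_def)
          moreover have "Z J = max 0
                ((\<Sum>k\<in>UNIV. q None (J k) * h (J k)) - (\<Sum>j\<in>UNIV. q None j * x $ j))
              + U * (\<Sum>i\<in>UNIV. M * max 0 ((\<Sum>k\<in>UNIV. q (Some i) (J k) * h (J k))
                          - (\<Sum>j\<in>UNIV. q (Some i) j * x $ j)))"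
            unfolding Z_def centred sum_option by (simp add: w_def sum_distrib_left mult.assoc)
          ultimately show ?thesis using cost by linarith
        qed
        also have "\<dots> \<le> c \<bullet> x + \<tau>" using J by simp
        finally have "ereal (sampled_vec c J \<bullet> z) \<le> ereal (c \<bullet> x + \<tau>)" by simp
        then have "lp_value (sampled_vec c J) (covering_feasible (sampled_cols A J) b)
            \<le> ereal (c \<bullet> x + \<tau>)"
          unfolding lp_value_def by (rule INF_lower2[OF z])
        then show ?thesis
          unfolding Delta_v_sampled_def Delta_v_distr_def v vx
          \<comment> \<open>The sampled value is bounded by a real number, and subtracting the real
            \<open>v\<close> on both sides keeps the order.\<close>
          by (cases "lp_value (sampled_vec c J) (covering_feasible (sampled_cols A J) b)") auto
      qed
      moreover have "Delta_v_distr A b c C \<xi> + ereal \<tau> \<le> Delta_v_distr A b c C \<xi>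
          + ereal (C / sqrt (real CARD('k)) * (1 + U_covering A c * real CARD('m) * max_norm A)
              * (1 + sqrt (2 * ln (2 / \<delta>))))"
        using \<tau> unfolding K_def M_def U_def by (intro add_left_mono) (simp only: ereal_less_eq)
      ultimately show ?thesis
        unfolding mem_Collect_eq by (blast intro: order_trans)
    qed
    then have sub: "- {J. Z J > \<tau>} \<subseteq> ?good"
      by (metis (no_types, lifting) ComplD linorder_not_less mem_Collect_eq subsetI)
    have "1 - \<delta> \<le> 1 - measure_pmf.prob (iid_sample \<xi>) {J. Z J > \<tau>}" using tail by simp
    also have "\<dots> = measure_pmf.prob (iid_sample \<xi>) (- {J. Z J > \<tau>})"
      using measure_pmf.prob_compl[of "{J. Z J > \<tau>}" "iid_sample \<xi>"] by (simp add: Compl_eq_Diff_UNIV)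
    also have "\<dots> \<le> measure_pmf.prob (iid_sample \<xi>) ?good"
      by (intro measure_pmf.finite_measure_mono sub) simp
    finally show ?thesis .
  qed
qed

end
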